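(* Assume: (E1) $X$ is a compact connected Hausdorff space and $\Phi\colon G\to\mathrm{Homeo}(X)$, $g\mapsto\Phi_g$, is an action of a topological group $G$ by homeomorphisms; (E2) each observation map $h_\alpha\colon X\to Y_\alpha$ ($\alpha\in A$) is continuous and the family jointly separates points, i.e. for all $x\neq x'$ in $X$ there is $\alpha\in A$ with $h_\alpha(x)\neq h_\alpha(x')$; (E3) $h_\alpha\circ\Phi_g=T^g_\alpha\circ h_\alpha$ for all $\alpha\in A$, $g\in G$; (E4) for every $x\neq x'$ in $X$ there exist $\pi\in\Pi$ and $k\in K$ with $P^{\pi,k}(\cdot\mid x)\neq P^{\pi,k}(\cdot\mid x')$. If the action $\Phi$ is simply transitive, so that $X$ is a principal homogeneous $G$-space, then $Z_{\mathrm{Homeo}(X)}(\Phi(G))\cong G$ acting by right translations. Consequently $X$ is recovered as a $G$-torsor: the observation family together with the intervention family determines everything about the space except the choice of an origin and a frame, and that choice is exactly the residual ambiguity, no more and no less.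
   Context: $A$ is a finite index set of modalities; $Y_\alpha$ is the observation space of modality $\alpha$, and $T^g_\alpha\colon Y_\alpha\to Y_\alpha$ is the transformation of modality $\alpha$ corresponding to $g\in G$. $\Pi$ is a countable class of policies and $K$ a countable set of prediction horizons; $P^{\pi,k}(\cdot\mid x)$ is the probability law of the next $k$ multimodal observations when policy $\pi$ is executed from state $x\in X$. $\mathrm{Homeo}(X)$ is the group of self-homeomorphisms of $X$, and $Z_{\mathrm{Homeo}(X)}(\Phi(G))$, the centraliser of the action, is the subgroup of those commuting with every $\Phi_g$. Simply transitive means that for all $x,x'\in X$ there is exactly one $g\in G$ with $\Phi_gx=x'$. Fixing a base point $x_0\in X$ and identifying $X$ with $G$ by $g\mapsto\Phi_gx_0$, right translation by $a\in G$ is the map $\Phi_gx_0\mapsto\Phi_{ga}x_0$. "Recovered" refers to representations $\varphi=z\circ H$ of $X$, where $H=(h_\alpha)_\alpha$ and $z\colon\prod_\alpha Y_\alpha\to Z$ is a continuous encoder through which every $P^{\pi,k}$ factors and which satisfies $z\circ(\prod_\alpha T^g_\alpha)=\Psi_g\circ z$ for an action $\Psi$ of $G$ on $Z$; the ambiguity between two such representations $\varphi,\varphi'$ is the map $\varphi'^{-1}\circ\varphi$, which under (E1)–(E4) is asserted to lie in $Z_{\mathrm{Homeo}(X)}(\Phi(G))$.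
   Formalization: Principal homogeneous is taken topologically: orbit maps g↦Φ_g x are assumed to be homeomorphisms G→X, since with simple transitivity alone right translations may be discontinuous. "No less" assumes some representation exists and realises each ambiguity in an enlarged Z. *)

theory Defs
  imports "HOL-Algebra.Bij" "HOL-Probability.Probability"
begin

definition topological_group :: "('g, 'm) monoid_scheme \<Rightarrow> 'g topology \<Rightarrow> bool" where
  "topological_group G TG \<longleftrightarrow>
     group G \<and> topspace TG = carrier G \<and>
     continuous_map (prod_topology TG TG) TG (\<lambda>(a, b). a \<otimes>\<^bsub>G\<^esub> b) \<and>
     continuous_map TG TG (m_inv G)"

text \<open>As in \<^const>\<open>BijGroup\<close>, self-maps are made canonical by being undefined off the
  space, and the product is composition.\<close>

definition HomeoGroup :: "'x topology \<Rightarrow> ('x \<Rightarrow> 'x) monoid" where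
  "HomeoGroup X =
     BijGroup (topspace X) \<lparr>carrier := {f \<in> Bij (topspace X). homeomorphic_map X X f}\<rparr>"

definition centraliser :: "('g, 'm) monoid_scheme \<Rightarrow> 'g set \<Rightarrow> ('g, 'm) monoid_scheme" where
  "centraliser H S =
     H \<lparr>carrier := {f \<in> carrier H. \<forall>s\<in>S. f \<otimes>\<^bsub>H\<^esub> s = s \<otimes>\<^bsub>H\<^esub> f}\<rparr>"

definition simply_transitive ::
    "('g, 'm) monoid_scheme \<Rightarrow> 'x topology \<Rightarrow> ('g \<Rightarrow> 'x \<Rightarrow> 'x) \<Rightarrow> bool" where
  "simply_transitive G X \<Phi> \<longleftrightarrow>
     (\<forall>x\<in>topspace X. \<forall>x'\<in>topspace X. \<exists>!g. g \<in> carrier G \<and> \<Phi> g x = x')"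

text \<open>Principal homogeneous spaces are taken in the topological category: the identification
  of \<open>G\<close> with the space by means of a base point is a homeomorphism, not only a bijection.
  (This makes the action jointly continuous.) It does not follow from simple transitivity
  alone, and without it right translations need not be continuous.\<close>

definition principal_homogeneous_space ::
    "('g, 'm) monoid_scheme \<Rightarrow> 'g topology \<Rightarrow> 'x topology \<Rightarrow> ('g \<Rightarrow> 'x \<Rightarrow> 'x) \<Rightarrow> bool" where
  "principal_homogeneous_space G TG X \<Phi> \<longleftrightarrow>
     \<Phi> \<in> hom G (HomeoGroup X) \<and> simply_transitive G X \<Phi> \<and>
     (\<forall>x\<in>topspace X. homeomorphic_map TG X (\<lambda>g. \<Phi> g x))"

text \<open>The map \<open>\<Phi> g x0 \<mapsto> \<Phi> (g \<otimes> a) x0\<close>.\<close>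

definition right_translation ::
    "('g, 'm) monoid_scheme \<Rightarrow> 'x topology \<Rightarrow> ('g \<Rightarrow> 'x \<Rightarrow> 'x) \<Rightarrow> 'x \<Rightarrow> 'g \<Rightarrow> 'x \<Rightarrow> 'x" where
  "right_translation G X \<Phi> x0 a =
     (\<lambda>x\<in>topspace X. \<Phi> (inv_into (carrier G) (\<lambda>g. \<Phi> g x0) x \<otimes>\<^bsub>G\<^esub> a) x0)"

definition joint_obs :: "'a set \<Rightarrow> ('a \<Rightarrow> 'x \<Rightarrow> 'y) \<Rightarrow> 'x \<Rightarrow> 'a \<Rightarrow> 'y" where
  "joint_obs A h x = (\<lambda>\<alpha>\<in>A. h \<alpha> x)"

text \<open>The measurable space of \<open>k\<close> successive multimodal observations, each modality carrying
  its Borel \<open>\<sigma>\<close>-algebra.\<close>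

definition obs_seq_space :: "('a \<Rightarrow> 'y topology) \<Rightarrow> 'a set \<Rightarrow> nat \<Rightarrow> (nat \<Rightarrow> 'a \<Rightarrow> 'y) measure" where
  "obs_seq_space Y A k =
     Pi\<^sub>M {..<k} (\<lambda>_. Pi\<^sub>M A (\<lambda>\<alpha>. sigma (topspace (Y \<alpha>)) {U. openin (Y \<alpha>) U}))"

text \<open>\<open>(Z, \<Psi>, z)\<close> is a latent \<open>G\<close>-space with an equivariant continuous encoder through which
  all predictive laws factor; the representation of \<open>X\<close> it gives is \<open>z \<circ> joint_obs A h\<close>.
  No separation axiom is imposed on \<open>Z\<close>.\<close>

definition latent_representation ::
    "('g, 'm) monoid_scheme \<Rightarrow> 'x topology \<Rightarrow> ('a \<Rightarrow> 'y topology) \<Rightarrow> 'a set \<Rightarrow> ('a \<Rightarrow> 'x \<Rightarrow> 'y) \<Rightarrow>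
     ('g \<Rightarrow> 'a \<Rightarrow> 'y \<Rightarrow> 'y) \<Rightarrow> 'p set \<Rightarrow> nat set \<Rightarrow>
     ('p \<Rightarrow> nat \<Rightarrow> 'x \<Rightarrow> (nat \<Rightarrow> 'a \<Rightarrow> 'y) measure) \<Rightarrow>
     'z topology \<Rightarrow> ('g \<Rightarrow> 'z \<Rightarrow> 'z) \<Rightarrow> (('a \<Rightarrow> 'y) \<Rightarrow> 'z) \<Rightarrow> bool" where
  "latent_representation G X Y A h T Pol K P Z \<Psi> z \<longleftrightarrow>
     \<Psi> \<in> hom G (HomeoGroup Z) \<and>
     continuous_map (product_topology Y A) Z z \<and>
     (\<forall>g\<in>carrier G. \<forall>y\<in>topspace (product_topology Y A).
        z (\<lambda>\<alpha>\<in>A. T g \<alpha> (y \<alpha>)) = \<Psi> g (z y)) \<and>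
     (\<forall>\<pi>\<in>Pol. \<forall>k\<in>K. \<exists>Q.
        (\<forall>p\<in>topspace Z. Q p \<in> space (prob_algebra (obs_seq_space Y A k))) \<and>
        (\<forall>x\<in>topspace X. P \<pi> k x = Q (z (joint_obs A h x))))"

text \<open>The self-map \<open>\<phi>'\<inverse> \<circ> \<phi>\<close> of \<open>X\<close>; meaningful when \<open>\<phi>'\<close> is injective on \<open>X\<close> and
  \<open>\<phi> ` X \<subseteq> \<phi>' ` X\<close>.\<close>

definition ambiguity :: "'x topology \<Rightarrow> ('x \<Rightarrow> 'z) \<Rightarrow> ('x \<Rightarrow> 'z) \<Rightarrow> 'x \<Rightarrow> 'x" where
  "ambiguity X \<phi> \<phi>' = (\<lambda>x\<in>topspace X. inv_into (topspace X) \<phi>' (\<phi> x))"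

end

theory Submission
  imports Defs
begin

text \<open>A self-map of a torsor that commutes with the action is determined by the image of the base
  point, hence is a right translation, and it is a homeomorphism because orbit maps are. The
  predictive laws separate points and factor through every representation, so representations are
  injective and equivariant; thus \<open>X\<close> is recovered up to a self-map commuting with the action.
  Conversely, given \<open>c\<close> in the centraliser and a representation \<open>\<phi>\<close> in \<open>Z\<close>, glue two copies of \<open>Z\<close>
  by identifying \<open>\<phi> x\<close> in the first with \<open>\<phi> (c x)\<close> in the second: the two inclusions of \<open>Z\<close> give
  representations whose ambiguity is \<open>c\<close>.\<close>

section \<open>Homeomorphism groups\<close>

lemma carrier_HomeoGroup:
  "f \<in> carrier (HomeoGroup X) \<longleftrightarrow> f \<in> extensional (topspace X) \<and> homeomorphic_map X X f"
proof -
  have "f \<in> carrier (HomeoGroup X) \<longleftrightarrow> f \<in> Bij (topspace X) \<and> homeomorphic_map X X f"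
    by (simp add: HomeoGroup_def)
  then show ?thesis
    using homeomorphic_imp_injective_map homeomorphic_imp_surjective_map
    unfolding Bij_def bij_betw_def by blast
qed

lemma mult_HomeoGroup:
  assumes "f \<in> carrier (HomeoGroup X)" "g \<in> carrier (HomeoGroup X)"
  shows "f \<otimes>\<^bsub>HomeoGroup X\<^esub> g = compose (topspace X) f g"
  using assms by (simp add: HomeoGroup_def BijGroup_def)

text \<open>Continuity of every \<open>\<Psi> g\<close> already yields homeomorphisms, because
  \<open>\<Psi> (inv g)\<close> is a continuous two-sided inverse.\<close>

lemma (in group) hom_HomeoGroupI:
  assumes ext: "\<And>g. g \<in> carrier G \<Longrightarrow> \<Psi> g \<in> extensional (topspace Z)"
    and cont: "\<And>g. g \<in> carrier G \<Longrightarrow> continuous_map Z Z (\<Psi> g)"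
    and one: "\<And>x. x \<in> topspace Z \<Longrightarrow> \<Psi> \<one> x = x"
    and mult: "\<And>g h x. g \<in> carrier G \<Longrightarrow> h \<in> carrier G \<Longrightarrow> x \<in> topspace Z \<Longrightarrow>
      \<Psi> (g \<otimes> h) x = \<Psi> g (\<Psi> h x)"
  shows "\<Psi> \<in> hom G (HomeoGroup Z)"
proof -
  have car: "\<Psi> g \<in> carrier (HomeoGroup Z)" if g: "g \<in> carrier G" for g
  proof -
    have "homeomorphic_maps Z Z (\<Psi> g) (\<Psi> (inv g))"
      unfolding homeomorphic_maps_def
      using cont[OF g] cont[of "inv g"] mult[of g "inv g", symmetric] mult[of "inv g" g, symmetric] g
      by (simp add: one)
    then show ?thesis
      unfolding carrier_HomeoGroup using ext[OF g] homeomorphic_map_maps by blast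
  qed
  moreover have "\<Psi> (g \<otimes> h) = compose (topspace Z) (\<Psi> g) (\<Psi> h)"
    if "g \<in> carrier G" "h \<in> carrier G" for g h
    using that by (intro extensionalityI[of _ "topspace Z"]) (auto simp: ext mult compose_def)
  ultimately show ?thesis
    by (auto simp: hom_def mult_HomeoGroup)
qed

context group
begin

context
  fixes \<Psi> :: "'a \<Rightarrow> 'z \<Rightarrow> 'z" and Z :: "'z topology"
  assumes \<Psi>: "\<Psi> \<in> hom G (HomeoGroup Z)"
begin

lemma hom_HomeoGroup_carrier: "g \<in> carrier G \<Longrightarrow> \<Psi> g \<in> carrier (HomeoGroup Z)"
  using \<Psi> by (auto simp: hom_def)

lemma hom_HomeoGroup_continuous: "g \<in> carrier G \<Longrightarrow> continuous_map Z Z (\<Psi> g)"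
  using hom_HomeoGroup_carrier by (auto simp: carrier_HomeoGroup homeomorphic_imp_continuous_map)

lemma hom_HomeoGroup_closed:
  "\<lbrakk>g \<in> carrier G; x \<in> topspace Z\<rbrakk> \<Longrightarrow> \<Psi> g x \<in> topspace Z"
  using continuous_map_image_subset_topspace[OF hom_HomeoGroup_continuous] by auto

lemma hom_HomeoGroup_mult:
  "\<lbrakk>g \<in> carrier G; h \<in> carrier G; x \<in> topspace Z\<rbrakk> \<Longrightarrow> \<Psi> (g \<otimes> h) x = \<Psi> g (\<Psi> h x)"
  using \<Psi> by (simp add: hom_mult mult_HomeoGroup hom_HomeoGroup_carrier compose_def)

text \<open>An injective idempotent map is the identity; idempotence comes from
  \<open>\<one> \<otimes> \<one> = \<one>\<close>.\<close>

lemma hom_HomeoGroup_one: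
  assumes "x \<in> topspace Z"
  shows "\<Psi> \<one> x = x"
proof -
  have "inj_on (\<Psi> \<one>) (topspace Z)"
    using hom_HomeoGroup_carrier[OF one_closed] homeomorphic_imp_injective_map
    unfolding carrier_HomeoGroup by blast
  moreover have "\<Psi> \<one> (\<Psi> \<one> x) = \<Psi> \<one> x"
    using hom_HomeoGroup_mult[of \<one> \<one> x] assms by simp
  ultimately show ?thesis
    using assms by (auto dest: inj_onD intro: hom_HomeoGroup_closed)
qed

lemma hom_HomeoGroup_inv:
  assumes "g \<in> carrier G" "x \<in> topspace Z"
  shows "\<Psi> (inv g) (\<Psi> g x) = x"
  using hom_HomeoGroup_mult[of "inv g" g x] assms by (simp add: hom_HomeoGroup_one)

end

end

section \<open>Right translations of a torsor\<close>

locale torsor = group G for G :: "('g, 'm) monoid_scheme" (structure) +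
  fixes TG :: "'g topology" and X :: "'x topology" and \<Phi> :: "'g \<Rightarrow> 'x \<Rightarrow> 'x" and x0 :: 'x
  assumes principal: "principal_homogeneous_space G TG X \<Phi>"
    and topspace_group: "topspace TG = carrier G"
    and base: "x0 \<in> topspace X"
begin

lemma action_hom: "\<Phi> \<in> hom G (HomeoGroup X)"
  using principal by (simp add: principal_homogeneous_space_def)

lemmas action_closed = hom_HomeoGroup_closed[OF action_hom]
lemmas action_mult = hom_HomeoGroup_mult[OF action_hom]
lemmas action_one = hom_HomeoGroup_one[OF action_hom]

lemma transitive:
  assumes "x \<in> topspace X" "y \<in> topspace X"
  obtains g where "g \<in> carrier G" "y = \<Phi> g x"
  using principal assms
  unfolding principal_homogeneous_space_def simply_transitive_def by metis

lemma free:
  assumes "x \<in> topspace X" "g \<in> carrier G" "h \<in> carrier G" "\<Phi> g x = \<Phi> h x"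
  shows "g = h"
  using principal assms action_closed
  unfolding principal_homogeneous_space_def simply_transitive_def by metis

lemma orbit_homeomorphic_map:
  "x \<in> topspace X \<Longrightarrow> homeomorphic_map TG X (\<lambda>g. \<Phi> g x)"
  using principal by (simp add: principal_homogeneous_space_def)

abbreviation R :: "'g \<Rightarrow> 'x \<Rightarrow> 'x" where "R \<equiv> right_translation G X \<Phi> x0"

text \<open>Freeness makes the orbit map of \<open>x0\<close> injective, so the
  \<open>inv_into\<close> in the definition returns \<open>g\<close> itself. Later computations with
  \<open>R\<close> go through this formula.\<close>

lemma right_translation_apply:
  assumes "g \<in> carrier G" "a \<in> carrier G"
  shows "R a (\<Phi> g x0) = \<Phi> (g \<otimes> a) x0"
proof -
  have "inj_on (\<lambda>g. \<Phi> g x0) (carrier G)"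
    using free base by (auto intro: inj_onI)
  then show ?thesis
    using assms inv_into_f_f[of "\<lambda>g. \<Phi> g x0" "carrier G" g]
    by (simp add: right_translation_def action_closed base)
qed

lemma right_translation_base:
  assumes "a \<in> carrier G"
  shows "R a x0 = \<Phi> a x0"
  using right_translation_apply[of \<one> a] assms by (simp add: action_one base)

text \<open>This is associativity: in the group coordinate, \<open>\<Phi> g\<close> multiplies on
  the left and \<open>R a\<close> on the right.\<close>

lemma right_translation_commute:
  assumes "g \<in> carrier G" "a \<in> carrier G" "x \<in> topspace X"
  shows "R a (\<Phi> g x) = \<Phi> g (R a x)"
proof -
  obtain k where k: "k \<in> carrier G" "x = \<Phi> k x0"
    using transitive[OF base assms(3)] .
  have "R a (\<Phi> g x) = R a (\<Phi> (g \<otimes> k) x0)"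
    using k assms base by (simp add: action_mult)
  also have "\<dots> = \<Phi> g (R a x)"
    using k assms base
    by (simp add: right_translation_apply m_assoc action_mult[of g "k \<otimes> a"])
  finally show ?thesis .
qed

text \<open>Both orbit maps \<open>g \<mapsto> \<Phi> g x0\<close> and \<open>g \<mapsto> \<Phi> g (\<Phi> a x0)\<close> are homeomorphisms from the
  group, and the translation by \<open>a\<close> is the second after the inverse of the first.\<close>

lemma right_translation_continuous:
  assumes a: "a \<in> carrier G"
  shows "continuous_map X X (R a)"
proof -
  obtain k where k: "homeomorphic_maps TG X (\<lambda>g. \<Phi> g x0) k"
    using orbit_homeomorphic_map[OF base] homeomorphic_map_maps by blast
  have "continuous_map X X ((\<lambda>g. \<Phi> g (\<Phi> a x0)) \<circ> k)"
  proof (rule continuous_map_compose)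
    show "continuous_map X TG k"
      using k by (simp add: homeomorphic_maps_def)
    show "continuous_map TG X (\<lambda>g. \<Phi> g (\<Phi> a x0))"
      using a base by (intro homeomorphic_imp_continuous_map orbit_homeomorphic_map action_closed)
  qed
  moreover have "((\<lambda>g. \<Phi> g (\<Phi> a x0)) \<circ> k) x = R a x" if x: "x \<in> topspace X" for x
  proof -
    obtain g where g: "g \<in> carrier G" "x = \<Phi> g x0"
      using transitive[OF base x] .
    then have "k x = g"
      using k by (simp add: homeomorphic_maps_def topspace_group)
    then show ?thesis
      using g a base by (simp add: right_translation_apply action_mult)
  qed
  ultimately show ?thesis
    using continuous_map_eq by blast
qed

lemma right_translation_mult:
  assumes "a \<in> carrier G" "b \<in> carrier G" "x \<in> topspace X"
  shows "R (b \<otimes> a) x = R a (R b x)"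
proof -
  obtain g where "g \<in> carrier G" "x = \<Phi> g x0"
    using transitive[OF base assms(3)] .
  then show ?thesis
    using assms by (simp add: right_translation_apply m_assoc)
qed

text \<open>\<open>R\<close> reverses products and inversion reverses them once more, so the
  composite preserves them. Continuity of the translations is the only topological input.\<close>

lemma right_translation_hom: "(\<lambda>a. R (inv a)) \<in> hom G (HomeoGroup X)"
proof (rule hom_HomeoGroupI)
  show "R (inv \<one>) x = x" if x: "x \<in> topspace X" for x
  proof -
    obtain g where "g \<in> carrier G" "x = \<Phi> g x0"
      using transitive[OF base x] .
    then show ?thesis
      by (simp add: right_translation_apply)
  qed
  show "R (inv a) \<in> extensional (topspace X)" for a
    by (simp add: right_translation_def)
qed (simp_all add: right_translation_continuous right_translation_mult inv_mult_group)

lemma right_translation_inj: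
  assumes "a \<in> carrier G" "b \<in> carrier G" "R a = R b"
  shows "a = b"
  using assms right_translation_base[of a] right_translation_base[of b] free[OF base] by metis

section \<open>Identification of the centraliser with the group\<close>

lemma centraliser_iff:
  "c \<in> carrier (centraliser (HomeoGroup X) (\<Phi> ` carrier G)) \<longleftrightarrow>
     c \<in> carrier (HomeoGroup X) \<and> (\<forall>g\<in>carrier G. \<forall>x\<in>topspace X. c (\<Phi> g x) = \<Phi> g (c x))"
proof (cases "c \<in> carrier (HomeoGroup X)")
  case True
  have "c \<otimes>\<^bsub>HomeoGroup X\<^esub> \<Phi> g = \<Phi> g \<otimes>\<^bsub>HomeoGroup X\<^esub> c \<longleftrightarrow>
      (\<forall>x\<in>topspace X. c (\<Phi> g x) = \<Phi> g (c x))" if g: "g \<in> carrier G" for g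
    unfolding mult_HomeoGroup[OF True hom_HomeoGroup_carrier[OF action_hom g]]
      mult_HomeoGroup[OF hom_HomeoGroup_carrier[OF action_hom g] True] compose_def
    by (auto simp: fun_eq_iff restrict_def)
  then show ?thesis
    using True by (auto simp: centraliser_def)
qed (simp add: centraliser_def)

lemma right_translation_in_centraliser:
  assumes "a \<in> carrier G"
  shows "R a \<in> carrier (centraliser (HomeoGroup X) (\<Phi> ` carrier G))"
  using hom_HomeoGroup_carrier[OF right_translation_hom, of "inv a"] assms
  by (simp add: centraliser_iff right_translation_commute)

text \<open>An equivariant self-map is determined by the image of the base point, so it is a right
  translation; no continuity is needed.\<close>

lemma equivariant_right_translation:
  assumes ext: "c \<in> extensional (topspace X)"
    and x0: "c x0 \<in> topspace X"
    and eq: "\<And>g x. g \<in> carrier G \<Longrightarrow> x \<in> topspace X \<Longrightarrow> c (\<Phi> g x) = \<Phi> g (c x)"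
  shows "\<exists>!a. a \<in> carrier G \<and> c = R a"
proof -
  obtain a where a: "a \<in> carrier G" "c x0 = \<Phi> a x0"
    using transitive[OF base x0] .
  have "c = R a"
  proof (rule extensionalityI[OF ext])
    show "R a \<in> extensional (topspace X)"
      by (simp add: right_translation_def)
    fix x assume "x \<in> topspace X"
    then obtain g where "g \<in> carrier G" "x = \<Phi> g x0"
      using transitive[OF base] by blast
    then show "c x = R a x"
      using a base by (simp add: eq right_translation_apply action_mult)
  qed
  then show ?thesis
    using a right_translation_inj by blast
qed

text \<open>Injective because \<open>a\<close> can be read off from the image of \<open>x0\<close>;
  onto because an element of the centraliser is an equivariant self-map, hence some
  \<open>R a\<close>.\<close>

theorem right_translation_iso:
  "(\<lambda>a. R (inv a)) \<in> iso G (centraliser (HomeoGroup X) (\<Phi> ` carrier G))"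
proof -
  have "bij_betw (\<lambda>a. R (inv a)) (carrier G) (carrier (centraliser (HomeoGroup X) (\<Phi> ` carrier G)))"
    unfolding bij_betw_def
  proof
    show "inj_on (\<lambda>a. R (inv a)) (carrier G)"
      by (rule inj_onI) (meson inv_closed inv_inj inj_onD right_translation_inj)
    have "c \<in> (\<lambda>a. R (inv a)) ` carrier G"
      if c: "c \<in> carrier (centraliser (HomeoGroup X) (\<Phi> ` carrier G))" for c
    proof -
      have "c x0 \<in> topspace X"
        using c base by (auto simp: centraliser_iff carrier_HomeoGroup
            dest: homeomorphic_imp_surjective_map)
      then obtain a where "a \<in> carrier G" "c = R a"
        using equivariant_right_translation[of c] c
        by (auto simp: centraliser_iff carrier_HomeoGroup)
      then have "inv a \<in> carrier G" "c = R (inv (inv a))"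
        by auto
      then show ?thesis
        by blast
    qed
    then show "(\<lambda>a. R (inv a)) ` carrier G = carrier (centraliser (HomeoGroup X) (\<Phi> ` carrier G))"
      using right_translation_in_centraliser by auto
  qed
  moreover have "(\<lambda>a. R (inv a)) \<in> hom G (centraliser (HomeoGroup X) (\<Phi> ` carrier G))"
    using right_translation_hom right_translation_in_centraliser
    by (auto simp: hom_def centraliser_def)
  ultimately show ?thesis
    by (simp add: iso_def)
qed

end

section \<open>Gluing two spaces\<close>

text \<open>This is the final topology for \<open>i\<close> and \<open>j\<close> on the union of
  their images. No quotient is formed: identifications are encoded by coincidences among values of
  \<open>i\<close> and \<open>j\<close>.\<close>

definition pushout_topology ::
    "'a topology \<Rightarrow> ('a \<Rightarrow> 'w) \<Rightarrow> 'b topology \<Rightarrow> ('b \<Rightarrow> 'w) \<Rightarrow> 'w topology" where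
  "pushout_topology Z1 i Z2 j = topology (\<lambda>U. U \<subseteq> i ` topspace Z1 \<union> j ` topspace Z2 \<and>
     openin Z1 {v \<in> topspace Z1. i v \<in> U} \<and> openin Z2 {v \<in> topspace Z2. j v \<in> U})"

lemma openin_pushout_topology:
  "openin (pushout_topology Z1 i Z2 j) U \<longleftrightarrow> U \<subseteq> i ` topspace Z1 \<union> j ` topspace Z2 \<and>
     openin Z1 {v \<in> topspace Z1. i v \<in> U} \<and> openin Z2 {v \<in> topspace Z2. j v \<in> U}"
proof -
  have Int: "{v \<in> S. f v \<in> U \<inter> V} = {v \<in> S. f v \<in> U} \<inter> {v \<in> S. f v \<in> V}"
    for f :: "'p \<Rightarrow> 'q" and S U V by auto
  have Un: "{v \<in> S. f v \<in> \<Union>\<K>} = (\<Union>U\<in>\<K>. {v \<in> S. f v \<in> U})"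
    for f :: "'p \<Rightarrow> 'q" and S \<K> by auto
  have "istopology (\<lambda>U. U \<subseteq> i ` topspace Z1 \<union> j ` topspace Z2 \<and>
     openin Z1 {v \<in> topspace Z1. i v \<in> U} \<and> openin Z2 {v \<in> topspace Z2. j v \<in> U})"
    unfolding istopology_def Int Un by auto
  then show ?thesis
    by (simp add: pushout_topology_def)
qed

lemma topspace_pushout_topology:
  "topspace (pushout_topology Z1 i Z2 j) = i ` topspace Z1 \<union> j ` topspace Z2"
proof
  have *: "{v \<in> topspace Z1. i v \<in> i ` topspace Z1 \<union> j ` topspace Z2} = topspace Z1"
    "{v \<in> topspace Z2. j v \<in> i ` topspace Z1 \<union> j ` topspace Z2} = topspace Z2" by auto
  have "openin (pushout_topology Z1 i Z2 j) (i ` topspace Z1 \<union> j ` topspace Z2)"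
    unfolding openin_pushout_topology * by simp
  then show "i ` topspace Z1 \<union> j ` topspace Z2 \<subseteq> topspace (pushout_topology Z1 i Z2 j)"
    by (rule openin_subset)
  show "topspace (pushout_topology Z1 i Z2 j) \<subseteq> i ` topspace Z1 \<union> j ` topspace Z2"
    using openin_topspace[of "pushout_topology Z1 i Z2 j"] by (simp only: openin_pushout_topology)
qed

lemma continuous_map_pushout_left: "continuous_map Z1 (pushout_topology Z1 i Z2 j) i"
  and continuous_map_pushout_right: "continuous_map Z2 (pushout_topology Z1 i Z2 j) j"
  by (auto simp: continuous_map topspace_pushout_topology openin_pushout_topology)

text \<open>Universal property of the final topology; it gives continuity of the action on the glued
  space.\<close>

lemma continuous_map_from_pushout:
  assumes "continuous_map Z1 W (f \<circ> i)" "continuous_map Z2 W (f \<circ> j)"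
  shows "continuous_map (pushout_topology Z1 i Z2 j) W f"
proof -
  let ?S = "topspace (pushout_topology Z1 i Z2 j)"
  have "{v \<in> topspace Z1. i v \<in> {w \<in> ?S. f w \<in> U}} = {v \<in> topspace Z1. (f \<circ> i) v \<in> U}"
    "{v \<in> topspace Z2. j v \<in> {w \<in> ?S. f w \<in> U}} = {v \<in> topspace Z2. (f \<circ> j) v \<in> U}" for U
    by (auto simp: topspace_pushout_topology)
  moreover have "f ` ?S \<subseteq> topspace W"
    using assms[THEN continuous_map_image_subset_topspace] by (auto simp: topspace_pushout_topology)
  moreover have "{w \<in> ?S. f w \<in> U} \<subseteq> i ` topspace Z1 \<union> j ` topspace Z2" for U
    by (auto simp: topspace_pushout_topology)
  ultimately show ?thesis
    using assms unfolding continuous_map openin_pushout_topology by simp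
qed

section \<open>The Hausdorff property of the glued space\<close>

text \<open>The images of \<open>C\<close> and \<open>D\<close> are disjoint and compact, so
  disjoint open sets contain them. Deleting the closed image of the complement of \<open>U\<close>
  (or \<open>V\<close>) cuts the trace on \<open>X\<close> down to exactly \<open>U\<close> (or
  \<open>V\<close>), which is what lets open sets on two sides be matched.\<close>

lemma embedded_separation:
  assumes X: "compact_space X" and Z: "Hausdorff_space Z"
    and e: "continuous_map X Z e" "inj_on e (topspace X)"
    and U: "openin X U" "U \<subseteq> C" "closedin X C" and V: "openin X V" "V \<subseteq> D" "closedin X D"
    and dj: "disjnt C D"
  obtains B B' where "openin Z B" "openin Z B'" "disjnt B B'"
    "\<And>x. x \<in> topspace X \<Longrightarrow> e x \<in> B \<longleftrightarrow> x \<in> U"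
    "\<And>x. x \<in> topspace X \<Longrightarrow> e x \<in> B' \<longleftrightarrow> x \<in> V"
proof -
  have cpt: "compactin Z (e ` C)" if "closedin X C" for C
    using X closedin_compact_space e(1) image_compactin that by blast
  have sub: "C \<subseteq> topspace X" "D \<subseteq> topspace X"
    using U V by (simp_all add: closedin_subset)
  have "disjnt (e ` C) (e ` D)"
    using dj inj_on_image_Int[OF e(2) sub] by (simp add: disjnt_def)
  then obtain O1 O2 where O: "openin Z O1" "openin Z O2" "disjnt O1 O2" "e ` C \<subseteq> O1" "e ` D \<subseteq> O2"
    using Hausdorff_space_compact_separation[OF Z cpt cpt] U V by metis
  have cl: "closedin Z (e ` (topspace X - U))" "closedin Z (e ` (topspace X - V))"
    using compactin_imp_closedin[OF Z cpt] U V by auto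
  show thesis
  proof
    show "openin Z (O1 - e ` (topspace X - U))" "openin Z (O2 - e ` (topspace X - V))"
      using O cl by auto
    show "disjnt (O1 - e ` (topspace X - U)) (O2 - e ` (topspace X - V))"
      using O(3) by (auto simp: disjnt_def)
    show "e x \<in> O1 - e ` (topspace X - U) \<longleftrightarrow> x \<in> U" if "x \<in> topspace X" for x
      using that O(4) U(2) inj_onD[OF e(2)] by blast
    show "e x \<in> O2 - e ` (topspace X - V) \<longleftrightarrow> x \<in> V" if "x \<in> topspace X" for x
      using that O(5) V(2) inj_onD[OF e(2)] by blast
  qed
qed

text \<open>The glued points are \<open>i (e1 x) = j (e2 x)\<close>. An open set of the pushout is a pair of open
  sets with the same trace on \<open>X\<close>, so separating two glued points amounts to extending a pair of
  open subsets of \<open>X\<close> to both sides; this is possible once their closures are disjoint.\<close>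

lemma Hausdorff_space_pushout:
  assumes X: "compact_space X" "Hausdorff_space X"
    and Z: "Hausdorff_space Z1" "Hausdorff_space Z2"
    and e1: "continuous_map X Z1 e1" "inj_on e1 (topspace X)"
    and e2: "continuous_map X Z2 e2" "inj_on e2 (topspace X)"
    and i: "inj_on i (topspace Z1)" and j: "inj_on j (topspace Z2)"
    and glue: "\<And>v w. v \<in> topspace Z1 \<Longrightarrow> w \<in> topspace Z2 \<Longrightarrow>
      i v = j w \<longleftrightarrow> (\<exists>x\<in>topspace X. v = e1 x \<and> w = e2 x)"
  shows "Hausdorff_space (pushout_topology Z1 i Z2 j)" (is "Hausdorff_space ?W")
proof -
  have e1_in: "e1 x \<in> topspace Z1" and e2_in: "e2 x \<in> topspace Z2" if "x \<in> topspace X" for x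
    using that continuous_map_image_subset_topspace[OF e1(1)]
      continuous_map_image_subset_topspace[OF e2(1)] by auto
  have cpt1: "compactin Z1 (e1 ` topspace X)" and cpt2: "compactin Z2 (e2 ` topspace X)"
    using X(1) e1(1) e2(1) image_compactin unfolding compact_space_def by blast+
  have cl1: "closedin Z1 (e1 ` topspace X)" and cl2: "closedin Z2 (e2 ` topspace X)"
    using cpt1 cpt2 Z by (auto intro: compactin_imp_closedin)
  \<comment> \<open>By injectivity and \<open>glue\<close>, agreement of the traces makes the
    preimages of this union exactly \<open>B1\<close> and \<open>B2\<close>.\<close>
  have pair: "openin ?W (i ` B1 \<union> j ` B2)"
    if B: "openin Z1 B1" "openin Z2 B2" "\<And>x. x \<in> topspace X \<Longrightarrow> e1 x \<in> B1 \<longleftrightarrow> e2 x \<in> B2" for B1 B2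
  proof -
    note sub = openin_subset[OF B(1)] openin_subset[OF B(2)]
    have "v \<in> B1" if v: "v \<in> topspace Z1" "i v \<in> i ` B1 \<union> j ` B2" for v
      using v(2)
    proof
      assume "i v \<in> j ` B2"
      then obtain w where "w \<in> B2" "i v = j w" by auto
      then show ?thesis
        using glue[OF v(1), of w] sub B(3) by auto
    qed (use v sub inj_onD[OF i, of v] in \<open>auto simp: subset_iff\<close>)
    then have 1: "{v \<in> topspace Z1. i v \<in> i ` B1 \<union> j ` B2} = B1"
      using sub by blast
    have "w \<in> B2" if w: "w \<in> topspace Z2" "j w \<in> i ` B1 \<union> j ` B2" for w
      using w(2)
    proof
      assume "j w \<in> i ` B1"
      then obtain v where "v \<in> B1" "i v = j w" by auto
      then show ?thesis
        using glue[OF _ w(1), of v] sub B(3) by auto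
    qed (use w sub inj_onD[OF j, of w] in \<open>auto simp: subset_iff\<close>)
    then have 2: "{w \<in> topspace Z2. j w \<in> i ` B1 \<union> j ` B2} = B2"
      using sub by blast
    show ?thesis
      unfolding openin_pushout_topology 1 2 using B sub by auto
  qed
  define Sep where
    "Sep p q \<longleftrightarrow> (\<exists>U V. openin ?W U \<and> openin ?W V \<and> p \<in> U \<and> q \<in> V \<and> disjnt U V)" for p q
  \<comment> \<open>Disjointness within each side suffices: if \<open>i v = j w\<close>, both come
    from one \<open>x\<close>, and agreement of the traces then places a point in two disjoint sets
    on the same side.\<close>
  have sep: "Sep p q"
    if B: "openin Z1 B1" "openin Z2 B2" "\<And>x. x \<in> topspace X \<Longrightarrow> e1 x \<in> B1 \<longleftrightarrow> e2 x \<in> B2"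
      and C: "openin Z1 C1" "openin Z2 C2" "\<And>x. x \<in> topspace X \<Longrightarrow> e1 x \<in> C1 \<longleftrightarrow> e2 x \<in> C2"
      and dj: "disjnt B1 C1" "disjnt B2 C2"
      and pq: "p \<in> i ` B1 \<union> j ` B2" "q \<in> i ` C1 \<union> j ` C2" for B1 B2 C1 C2 p q
  proof -
    note sub = openin_subset[OF B(1)] openin_subset[OF B(2)]
      openin_subset[OF C(1)] openin_subset[OF C(2)]
    have 1: "i v \<noteq> i w" if "v \<in> B1" "w \<in> C1" for v w
      using that sub inj_onD[OF i, of v w] dj by (auto simp: disjnt_iff subset_iff)
    have 2: "j v \<noteq> j w" if "v \<in> B2" "w \<in> C2" for v w
      using that sub inj_onD[OF j, of v w] dj by (auto simp: disjnt_iff subset_iff)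
    have 3: "i v \<noteq> j w" if "v \<in> B1" "w \<in> C2" for v w
      using that sub glue[of v w] dj B(3) by (auto simp: disjnt_iff subset_iff)
    have 4: "i v \<noteq> j w" if "v \<in> C1" "w \<in> B2" for v w
      using that sub glue[of v w] dj C(3) by (auto simp: disjnt_iff subset_iff)
    have "a \<noteq> b" if "a \<in> i ` B1 \<union> j ` B2" "b \<in> i ` C1 \<union> j ` C2" for a b
      using that by (elim UnE imageE) (simp_all add: 1 2 3 4[THEN not_sym])
    then have "disjnt (i ` B1 \<union> j ` B2) (i ` C1 \<union> j ` C2)"
      unfolding disjnt_iff by blast
    then show ?thesis
      unfolding Sep_def using pair[OF B] pair[OF C] pq by blast
  qed
  have sym: "Sep p q" if "Sep q p" for p q
    using that unfolding Sep_def by (metis disjnt_sym)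
  have glued: "i (e1 x) = j (e2 x)" if "x \<in> topspace X" for x
    using that glue e1_in e2_in by blast
  \<comment> \<open>Regularity of \<open>X\<close> shrinks \<open>U0\<close> and \<open>V0\<close>
    to closed neighbourhoods \<open>C\<close> and \<open>D\<close>. Applying
    \<open>embedded_separation\<close> on both sides with the same \<open>U\<close> and
    \<open>V\<close> makes the traces agree.\<close>
  have xx: "Sep (i (e1 x)) (i (e1 y))" if xy: "x \<in> topspace X" "y \<in> topspace X" "x \<noteq> y" for x y
  proof -
    obtain U0 V0 where UV0: "openin X U0" "openin X V0" "x \<in> U0" "y \<in> V0" "disjnt U0 V0"
      using X(2) xy unfolding Hausdorff_space_def by metis
    have base: "neighbourhood_base_of (closedin X) X"
      using X by (simp add: neighbourhood_base_of_closedin compact_Hausdorff_imp_regular_space)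
    obtain U C where U: "openin X U" "closedin X C" "x \<in> U" "U \<subseteq> C" "C \<subseteq> U0"
      using base UV0 unfolding neighbourhood_base_of by metis
    obtain V D where V: "openin X V" "closedin X D" "y \<in> V" "V \<subseteq> D" "D \<subseteq> V0"
      using base UV0 unfolding neighbourhood_base_of by metis
    have dj: "disjnt C D"
      using UV0(5) U(5) V(5) by (auto simp: disjnt_iff)
    obtain B1 C1 where 1: "openin Z1 B1" "openin Z1 C1" "disjnt B1 C1"
      "\<And>x. x \<in> topspace X \<Longrightarrow> e1 x \<in> B1 \<longleftrightarrow> x \<in> U" "\<And>x. x \<in> topspace X \<Longrightarrow> e1 x \<in> C1 \<longleftrightarrow> x \<in> V"
      using embedded_separation[OF X(1) Z(1) e1 U(1,4,2) V(1,4,2) dj] by blast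
    obtain B2 C2 where 2: "openin Z2 B2" "openin Z2 C2" "disjnt B2 C2"
      "\<And>x. x \<in> topspace X \<Longrightarrow> e2 x \<in> B2 \<longleftrightarrow> x \<in> U" "\<And>x. x \<in> topspace X \<Longrightarrow> e2 x \<in> C2 \<longleftrightarrow> x \<in> V"
      using embedded_separation[OF X(1) Z(2) e2 U(1,4,2) V(1,4,2) dj] by blast
    show ?thesis
      by (rule sep[of B1 B2 C1 C2]) (use 1 2 U V xy in auto)
  qed
  \<comment> \<open>\<open>B\<close> contains the whole image of \<open>X\<close>, so its partner is
    all of \<open>Z2\<close>; \<open>C\<close> then misses that image, so its partner is
    empty.\<close>
  have xi: "Sep (i (e1 x)) (i v)"
    if xv: "x \<in> topspace X" "v \<in> topspace Z1" "v \<notin> e1 ` topspace X" for x v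
  proof -
    obtain B C where "openin Z1 B" "openin Z1 C" "e1 ` topspace X \<subseteq> B" "{v} \<subseteq> C" "disjnt B C"
      using Hausdorff_space_compact_separation[OF Z(1) cpt1, of "{v}"] xv by auto
    then show ?thesis
      by (intro sep[of B "topspace Z2" C "{}"]) (use xv e2_in in \<open>auto simp: disjnt_iff subset_iff\<close>)
  qed
  have xj: "Sep (i (e1 x)) (j w)"
    if xw: "x \<in> topspace X" "w \<in> topspace Z2" "w \<notin> e2 ` topspace X" for x w
  proof -
    obtain B C where "openin Z2 B" "openin Z2 C" "e2 ` topspace X \<subseteq> B" "{w} \<subseteq> C" "disjnt B C"
      using Hausdorff_space_compact_separation[OF Z(2) cpt2, of "{w}"] xw by auto
    then show ?thesis
      by (intro sep[of "topspace Z1" B "{}" C]) (use xw e1_in in \<open>auto simp: disjnt_iff subset_iff\<close>)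
  qed
  \<comment> \<open>Removing the closed image of \<open>X\<close> leaves open sets with empty trace,
    whose partner can be the empty set.\<close>
  have ii: "Sep (i v) (i w)"
    if vw: "v \<in> topspace Z1" "w \<in> topspace Z1" "v \<notin> e1 ` topspace X" "w \<notin> e1 ` topspace X" "v \<noteq> w"
    for v w
  proof -
    obtain B C where "openin Z1 B" "openin Z1 C" "v \<in> B" "w \<in> C" "disjnt B C"
      using Z(1) vw unfolding Hausdorff_space_def by metis
    then show ?thesis
      by (intro sep[of "B - e1 ` topspace X" "{}" "C - e1 ` topspace X" "{}"])
        (use vw cl1 in \<open>auto simp: disjnt_iff\<close>)
  qed
  have jj: "Sep (j v) (j w)"
    if vw: "v \<in> topspace Z2" "w \<in> topspace Z2" "v \<notin> e2 ` topspace X" "w \<notin> e2 ` topspace X" "v \<noteq> w"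
    for v w
  proof -
    obtain B C where "openin Z2 B" "openin Z2 C" "v \<in> B" "w \<in> C" "disjnt B C"
      using Z(2) vw unfolding Hausdorff_space_def by metis
    then show ?thesis
      by (intro sep[of "{}" "B - e2 ` topspace X" "{}" "C - e2 ` topspace X"])
        (use vw cl2 in \<open>auto simp: disjnt_iff\<close>)
  qed
  have ij: "Sep (i v) (j w)"
    if vw: "v \<in> topspace Z1" "w \<in> topspace Z2" "v \<notin> e1 ` topspace X" "w \<notin> e2 ` topspace X" for v w
    by (rule sep[of "topspace Z1 - e1 ` topspace X" "{}" "{}" "topspace Z2 - e2 ` topspace X"])
      (use vw cl1 cl2 in auto)
  \<comment> \<open>Glued points are always written through \<open>i\<close>, so up to symmetry the
    six combinations treated above cover all pairs.\<close>
  have cases: "(\<exists>x\<in>topspace X. p = i (e1 x)) \<or> (\<exists>v\<in>topspace Z1 - e1 ` topspace X. p = i v) \<or>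
      (\<exists>w\<in>topspace Z2 - e2 ` topspace X. p = j w)" if "p \<in> topspace ?W" for p
    using that unfolding topspace_pushout_topology
  proof (elim UnE imageE)
    fix w assume "w \<in> topspace Z2" "p = j w"
    then show ?thesis
      using glued by (cases "w \<in> e2 ` topspace X") auto
  qed auto
  have "Sep p q" if p: "p \<in> topspace ?W" and q: "q \<in> topspace ?W" and "p \<noteq> q" for p q
    using cases[OF p]
  proof (elim disjE bexE)
    fix x assume "x \<in> topspace X" "p = i (e1 x)"
    then show ?thesis
      using cases[OF q] \<open>p \<noteq> q\<close> by (elim disjE bexE) (auto intro: xx xi xj)
  next
    fix v assume "v \<in> topspace Z1 - e1 ` topspace X" "p = i v"
    then show ?thesis
      using cases[OF q] \<open>p \<noteq> q\<close> by (elim disjE bexE) (auto intro: xi[THEN sym] ii ij)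
  next
    fix w assume "w \<in> topspace Z2 - e2 ` topspace X" "p = j w"
    then show ?thesis
      using cases[OF q] \<open>p \<noteq> q\<close> by (elim disjE bexE) (auto intro: xj[THEN sym] ij[THEN sym] jj)
  qed
  then show ?thesis
    unfolding Hausdorff_space_def Sep_def by blast
qed

section \<open>Representations of an observed torsor\<close>

locale observed_torsor = torsor G TG X \<Phi> x0
  for G :: "('g, 'm) monoid_scheme" (structure) and TG X and \<Phi> :: "'g \<Rightarrow> 'x \<Rightarrow> 'x" and x0 +
  fixes A :: "'a set" and Y :: "'a \<Rightarrow> 'y topology" and h :: "'a \<Rightarrow> 'x \<Rightarrow> 'y"
    and T :: "'g \<Rightarrow> 'a \<Rightarrow> 'y \<Rightarrow> 'y" and Pol :: "'p set" and K :: "nat set"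
    and P :: "'p \<Rightarrow> nat \<Rightarrow> 'x \<Rightarrow> (nat \<Rightarrow> 'a \<Rightarrow> 'y) measure"
  assumes compact: "compact_space X" and Hausdorff: "Hausdorff_space X"
    and obs_continuous: "\<And>\<alpha>. \<alpha> \<in> A \<Longrightarrow> continuous_map X (Y \<alpha>) (h \<alpha>)"
    and obs_equivariant: "\<And>\<alpha> g x. \<alpha> \<in> A \<Longrightarrow> g \<in> carrier G \<Longrightarrow> x \<in> topspace X \<Longrightarrow>
      h \<alpha> (\<Phi> g x) = T g \<alpha> (h \<alpha> x)"
    and laws_separate: "\<And>x x'. x \<in> topspace X \<Longrightarrow> x' \<in> topspace X \<Longrightarrow> x \<noteq> x' \<Longrightarrow>
      \<exists>\<pi>\<in>Pol. \<exists>k\<in>K. P \<pi> k x \<noteq> P \<pi> k x'"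
begin

abbreviation representation ::
    "'z topology \<Rightarrow> ('g \<Rightarrow> 'z \<Rightarrow> 'z) \<Rightarrow> (('a \<Rightarrow> 'y) \<Rightarrow> 'z) \<Rightarrow> bool" where
  "representation Z \<Psi> z \<equiv> latent_representation G X Y A h T Pol K P Z \<Psi> z"

lemma joint_obs_continuous: "continuous_map X (product_topology Y A) (joint_obs A h)"
  using obs_continuous by (auto simp: continuous_map_componentwise joint_obs_def)

lemma joint_obs_in: "x \<in> topspace X \<Longrightarrow> joint_obs A h x \<in> topspace (product_topology Y A)"
  using continuous_map_image_subset_topspace[OF joint_obs_continuous] by auto

lemma representation_hom: "representation Z \<Psi> z \<Longrightarrow> \<Psi> \<in> hom G (HomeoGroup Z)"
  by (simp add: latent_representation_def)

lemma representation_factor: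
  assumes "representation Z \<Psi> z" "\<pi> \<in> Pol" "k \<in> K"
  shows "\<exists>Q. (\<forall>p\<in>topspace Z. Q p \<in> space (prob_algebra (obs_seq_space Y A k))) \<and>
    (\<forall>x\<in>topspace X. P \<pi> k x = Q (z (joint_obs A h x)))"
  using assms(1)[unfolded latent_representation_def, THEN conjunct2, THEN conjunct2, THEN conjunct2,
      THEN bspec, OF assms(2), THEN bspec, OF assms(3)] .

lemma representation_continuous:
  "representation Z \<Psi> z \<Longrightarrow> continuous_map X Z (z \<circ> joint_obs A h)"
  by (auto simp: latent_representation_def intro: continuous_map_compose joint_obs_continuous)

text \<open>The code \<open>z (joint_obs A h x)\<close> determines every predictive law at
  \<open>x\<close>, so states with equal codes would contradict
  \<open>laws_separate\<close>.\<close>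

lemma representation_inj:
  assumes "representation Z \<Psi> z"
  shows "inj_on (z \<circ> joint_obs A h) (topspace X)"
proof (rule inj_onI, rule ccontr)
  fix x x' assume x: "x \<in> topspace X" "x' \<in> topspace X" "x \<noteq> x'"
    and eq: "(z \<circ> joint_obs A h) x = (z \<circ> joint_obs A h) x'"
  obtain \<pi> k where "\<pi> \<in> Pol" "k \<in> K" "P \<pi> k x \<noteq> P \<pi> k x'"
    using laws_separate[OF x] by blast
  moreover obtain Q where "\<forall>x\<in>topspace X. P \<pi> k x = Q (z (joint_obs A h x))"
    using representation_factor[OF assms calculation(1,2)] by (elim exE conjE)
  ultimately show False
    using x eq by simp
qed

lemma representation_equivariant:
  assumes "representation Z \<Psi> z" "g \<in> carrier G" "x \<in> topspace X"
  shows "(z \<circ> joint_obs A h) (\<Phi> g x) = \<Psi> g ((z \<circ> joint_obs A h) x)"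
proof -
  have "joint_obs A h (\<Phi> g x) = (\<lambda>\<alpha>\<in>A. T g \<alpha> (joint_obs A h x \<alpha>))"
    using assms obs_equivariant by (auto simp: joint_obs_def)
  then show ?thesis
    using assms joint_obs_in[OF assms(3)] by (simp add: latent_representation_def)
qed

text \<open>A continuous injection from a compact space into a Hausdorff space is an
  embedding.\<close>

lemma representation_embedding:
  assumes "representation Z \<Psi> z" "Hausdorff_space Z"
  shows "embedding_map X Z (z \<circ> joint_obs A h)"
  using assms compact
  by (intro continuous_imp_embedding_map representation_continuous representation_inj)

text \<open>By equivariance and injectivity, \<open>\<Psi> g (\<phi> x) = \<phi> y\<close> holds
  exactly when \<open>\<Phi> g x = y\<close>, so existence and uniqueness of \<open>g\<close>
  transfer from \<open>X\<close>.\<close>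

lemma representation_simply_transitive:
  assumes rep: "representation Z \<Psi> z"
  defines "\<phi> \<equiv> z \<circ> joint_obs A h"
  shows "simply_transitive G (subtopology Z (\<phi> ` topspace X)) \<Psi>"
proof -
  have "topspace (subtopology Z (\<phi> ` topspace X)) = \<phi> ` topspace X"
    using continuous_map_image_subset_topspace[OF representation_continuous[OF rep]]
    by (auto simp: \<phi>_def)
  moreover have "\<exists>!g. g \<in> carrier G \<and> \<Psi> g (\<phi> x) = \<phi> y" if xy: "x \<in> topspace X" "y \<in> topspace X" for x y
  proof -
    have "\<Psi> g (\<phi> x) = \<phi> y \<longleftrightarrow> \<Phi> g x = y" if "g \<in> carrier G" for g
      using representation_equivariant[OF rep that xy(1)] inj_onD[OF representation_inj[OF rep]]
        action_closed[OF that xy(1)] xy(2)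
      unfolding \<phi>_def by metis
    then show ?thesis
      using transitive[OF xy] free[OF xy(1)] by metis
  qed
  ultimately show ?thesis
    by (auto simp: simply_transitive_def)
qed

text \<open>The orbit map of \<open>\<phi> x\<close> is \<open>\<phi>\<close> after the orbit map of
  \<open>x\<close>, a composite of homeomorphisms. Each \<open>\<Psi> g\<close> is restricted
  because members of \<open>HomeoGroup\<close> are undefined off their space.\<close>

lemma representation_torsor:
  assumes rep: "representation Z \<Psi> z" and Z: "Hausdorff_space Z"
  defines "\<phi> \<equiv> z \<circ> joint_obs A h"
  shows "principal_homogeneous_space G TG (subtopology Z (\<phi> ` topspace X))
    (\<lambda>g. restrict (\<Psi> g) (\<phi> ` topspace X))"
    (is "principal_homogeneous_space G TG ?W ?\<Psi>")
proof -
  have top: "topspace ?W = \<phi> ` topspace X"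
    using continuous_map_image_subset_topspace[OF representation_continuous[OF rep]]
    by (auto simp: \<phi>_def)
  have \<phi>_eq: "\<Psi> g (\<phi> x) = \<phi> (\<Phi> g x)" if "g \<in> carrier G" "x \<in> topspace X" for g x
    using representation_equivariant[OF rep that] by (simp add: \<phi>_def)
  note hom = representation_hom[OF rep]
  have "?\<Psi> \<in> hom G (HomeoGroup ?W)"
  proof (rule hom_HomeoGroupI)
    fix g assume g: "g \<in> carrier G"
    have "continuous_map ?W ?W (\<Psi> g)"
      using hom_HomeoGroup_continuous[OF hom g] g action_closed top
      by (auto simp: continuous_map_in_subtopology \<phi>_eq intro: continuous_map_from_subtopology)
    then show "continuous_map ?W ?W (?\<Psi> g)"
      by (rule continuous_map_eq) (use top in auto)
    show "?\<Psi> g \<in> extensional (topspace ?W)"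
      unfolding top by simp
  next
    fix y assume "y \<in> topspace ?W"
    then obtain x where x: "x \<in> topspace X" "y = \<phi> x"
      using top by auto
    then show "?\<Psi> \<one> y = y"
      by (simp add: \<phi>_eq action_one)
    show "?\<Psi> (g \<otimes> k) y = ?\<Psi> g (?\<Psi> k y)" if "g \<in> carrier G" "k \<in> carrier G" for g k
      using x that by (simp add: \<phi>_eq action_closed action_mult)
  qed
  moreover have "simply_transitive G ?W ?\<Psi>"
    using representation_simply_transitive[OF rep]
    unfolding simply_transitive_def \<phi>_def[symmetric] top by (simp cong: conj_cong)
  moreover have "homeomorphic_map TG ?W (\<lambda>g. ?\<Psi> g y)" if y: "y \<in> topspace ?W" for y
  proof -
    obtain x where x: "x \<in> topspace X" "y = \<phi> x"
      using y top by auto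
    have "homeomorphic_map TG ?W (\<phi> \<circ> (\<lambda>g. \<Phi> g x))"
      using orbit_homeomorphic_map[OF x(1)] representation_embedding[OF rep Z]
      unfolding \<phi>_def embedding_map_def by (rule homeomorphic_map_compose)
    then show ?thesis
      by (rule homeomorphic_map_eq) (use x in \<open>simp add: \<phi>_eq topspace_group\<close>)
  qed
  ultimately show ?thesis
    by (simp add: principal_homogeneous_space_def)
qed

section \<open>Ambiguities and their realisation\<close>

text \<open>The inclusion of images makes \<open>inv_into\<close> a true preimage, so
  \<open>\<phi>'\<close> after the ambiguity is \<open>\<phi>\<close> on \<open>X\<close>. Both
  encoders intertwine with the same \<open>\<Psi>\<close>; cancelling the injective
  \<open>\<phi>'\<close> gives equivariance.\<close>

lemma ambiguity_equivariant:
  assumes rep: "representation Z \<Psi> z" "representation Z \<Psi> z'"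
  defines "\<phi> \<equiv> z \<circ> joint_obs A h" and "\<phi>' \<equiv> z' \<circ> joint_obs A h"
  assumes sub: "\<phi> ` topspace X \<subseteq> \<phi>' ` topspace X"
  shows "\<exists>!a. a \<in> carrier G \<and> ambiguity X \<phi> \<phi>' = R a"
proof (rule equivariant_right_translation)
  let ?c = "ambiguity X \<phi> \<phi>'"
  have c: "?c x \<in> topspace X" "\<phi>' (?c x) = \<phi> x" if "x \<in> topspace X" for x
    using that sub inv_into_into[of "\<phi> x" \<phi>' "topspace X"] f_inv_into_f[of "\<phi> x" \<phi>' "topspace X"]
    by (auto simp: ambiguity_def image_subset_iff)
  show "?c \<in> extensional (topspace X)"
    by (simp add: ambiguity_def)
  show "?c x0 \<in> topspace X"
    using c base by blast
  show "?c (\<Phi> g x) = \<Phi> g (?c x)" if g: "g \<in> carrier G" and x: "x \<in> topspace X" for g x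
  proof (rule inj_onD[OF representation_inj[OF rep(2)]], fold \<phi>'_def)
    show "\<phi>' (?c (\<Phi> g x)) = \<phi>' (\<Phi> g (?c x))"
      using representation_equivariant[OF rep(1) g x] representation_equivariant[OF rep(2) g c(1)[OF x]]
        c(2)[OF x] c(2)[OF action_closed[OF g x]]
      by (simp add: \<phi>_def \<phi>'_def)
  qed (use g x c action_closed in auto)
qed

text \<open>The laws factor through \<open>i \<circ> z\<close> because \<open>i\<close> has a left inverse; off the image of \<open>i\<close> the
  factor is extended by its value at an arbitrary point.\<close>

lemma representation_extend:
  assumes rep: "representation Z \<Psi> z"
    and i: "continuous_map Z Z' i" "inj_on i (topspace Z)"
    and hom: "\<Psi>' \<in> hom G (HomeoGroup Z')"
    and eq: "\<And>g v. g \<in> carrier G \<Longrightarrow> v \<in> topspace Z \<Longrightarrow> i (\<Psi> g v) = \<Psi>' g (i v)"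
  shows "representation Z' \<Psi>' (i \<circ> z)"
proof -
  have z: "continuous_map (product_topology Y A) Z z"
    using rep by (simp add: latent_representation_def)
  have z_in: "z y \<in> topspace Z" if "y \<in> topspace (product_topology Y A)" for y
    using that continuous_map_image_subset_topspace[OF z] by auto
  have "\<exists>Q'. (\<forall>p\<in>topspace Z'. Q' p \<in> space (prob_algebra (obs_seq_space Y A k))) \<and>
      (\<forall>x\<in>topspace X. P \<pi> k x = Q' ((i \<circ> z) (joint_obs A h x)))"
    if \<pi>: "\<pi> \<in> Pol" and k: "k \<in> K" for \<pi> k
  proof -
    obtain Q where Q: "\<forall>p\<in>topspace Z. Q p \<in> space (prob_algebra (obs_seq_space Y A k))"
        "\<forall>x\<in>topspace X. P \<pi> k x = Q (z (joint_obs A h x))"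
      using representation_factor[OF rep \<pi> k] by (elim exE conjE)
    define r where
      "r p = (if p \<in> i ` topspace Z then inv_into (topspace Z) i p else z (joint_obs A h x0))" for p
    have "r p \<in> topspace Z" for p
      using z_in[OF joint_obs_in[OF base]] by (auto simp: r_def intro: inv_into_into)
    moreover have "r (i v) = v" if "v \<in> topspace Z" for v
      using that i(2) by (simp add: r_def)
    ultimately have "\<forall>p\<in>topspace Z'. (Q \<circ> r) p \<in> space (prob_algebra (obs_seq_space Y A k))"
      "\<forall>x\<in>topspace X. P \<pi> k x = (Q \<circ> r) ((i \<circ> z) (joint_obs A h x))"
      using Q z_in[OF joint_obs_in] by (simp_all add: comp_def)
    then show ?thesis
      by blast
  qed
  then show ?thesis
    using rep hom eq z_in continuous_map_compose[OF z i(1)] by (simp add: latent_representation_def)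
qed

text \<open>The latent space realising \<open>c\<close> consists of two copies of \<open>Z\<close> glued along the images of \<open>X\<close>
  under \<open>\<phi>\<close> and \<open>\<phi> \<circ> c\<close>. On the carrier level the second copy keeps only its points off the
  image of \<open>X\<close>; the others are replaced by their partners in the first.\<close>

lemma centraliser_realised:
  fixes Z :: "'z topology"
  assumes rep: "representation Z \<Psi> z"
    and c: "c \<in> carrier (centraliser (HomeoGroup X) (\<Phi> ` carrier G))"
  obtains Z' :: "('z + 'z) topology" and \<Psi>' z1 z2
  where "Hausdorff_space Z \<longrightarrow> Hausdorff_space Z'"
    "representation Z' \<Psi>' z1" "representation Z' \<Psi>' z2"
    "(z1 \<circ> joint_obs A h) ` topspace X = (z2 \<circ> joint_obs A h) ` topspace X"
    "ambiguity X (z1 \<circ> joint_obs A h) (z2 \<circ> joint_obs A h) = c"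
proof -
  define \<phi> where "\<phi> = z \<circ> joint_obs A h"
  note hom = representation_hom[OF rep]
  have c_ext: "c \<in> extensional (topspace X)" and c_homeo: "homeomorphic_map X X c"
    and c_eq: "\<And>g x. g \<in> carrier G \<Longrightarrow> x \<in> topspace X \<Longrightarrow> c (\<Phi> g x) = \<Phi> g (c x)"
    using c by (auto simp: centraliser_iff carrier_HomeoGroup)
  have c_img: "c ` topspace X = topspace X" and c_inj: "inj_on c (topspace X)"
    using c_homeo by (auto simp: homeomorphic_imp_surjective_map homeomorphic_imp_injective_map)
  have c_in: "c x \<in> topspace X" if "x \<in> topspace X" for x
    using c_img that by blast
  have \<phi>_cont: "continuous_map X Z \<phi>" and \<phi>_inj: "inj_on \<phi> (topspace X)"
    using representation_continuous[OF rep] representation_inj[OF rep] by (simp_all add: \<phi>_def)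
  have \<phi>_in: "\<phi> x \<in> topspace Z" if "x \<in> topspace X" for x
    using that continuous_map_image_subset_topspace[OF \<phi>_cont] by auto
  have \<phi>_eq: "\<Psi> g (\<phi> x) = \<phi> (\<Phi> g x)" if "g \<in> carrier G" "x \<in> topspace X" for g x
    using representation_equivariant[OF rep that] by (simp add: \<phi>_def)
  \<comment> \<open>\<open>e\<close> is again continuous, injective and equivariant, the last
    because \<open>c\<close> commutes with the action; hence gluing along \<open>\<phi>\<close> and
    \<open>e\<close> is compatible with \<open>\<Psi>\<close>.\<close>
  define e where "e = \<phi> \<circ> c"
  have e_cont: "continuous_map X Z e"
    unfolding e_def using homeomorphic_imp_continuous_map[OF c_homeo] \<phi>_cont
    by (rule continuous_map_compose)
  have e_inj: "inj_on e (topspace X)"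
    unfolding e_def using c_inj \<phi>_inj c_img by (auto intro: comp_inj_on)
  have e_eq: "\<Psi> g (e x) = e (\<Phi> g x)" if "g \<in> carrier G" "x \<in> topspace X" for g x
    using that by (simp add: e_def \<phi>_eq c_eq c_in)
  define i :: "'z \<Rightarrow> 'z + 'z" where "i = Inl"
  define j where
    "j v = (if v \<in> e ` topspace X then Inl (\<phi> (inv_into (topspace X) e v)) else Inr v)" for v
  have j_e: "j (e x) = i (\<phi> x)" if "x \<in> topspace X" for x
    using that e_inj by (simp add: i_def j_def)
  have i_inj: "inj_on i (topspace Z)"
    by (simp add: i_def)
  have j_inj: "inj_on j (topspace Z)"
  proof (rule inj_onI)
    fix v w assume "j v = j w"
    then show "v = w"
      using \<phi>_inj e_inj by (auto simp: j_def inj_on_eq_iff split: if_splits)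
  qed
  have glue: "i v = j w \<longleftrightarrow> (\<exists>x\<in>topspace X. v = \<phi> x \<and> w = e x)" for v w
  proof
    assume "i v = j w"
    then show "\<exists>x\<in>topspace X. v = \<phi> x \<and> w = e x"
      using e_inj by (auto simp: i_def j_def split: if_splits)
  qed (auto simp: j_e)
  define Z' where "Z' = pushout_topology Z i Z j"
  have top: "topspace Z' = i ` topspace Z \<union> j ` topspace Z"
    by (simp add: Z'_def topspace_pushout_topology)
  \<comment> \<open>Acting summand by summand respects the gluing: \<open>e x\<close> is stored as
    \<open>Inl (\<phi> x)\<close>, which is sent to \<open>Inl (\<phi> (\<Phi> g x))\<close>, the
    stored form of \<open>e (\<Phi> g x)\<close>.\<close>
  define \<Psi>' where "\<Psi>' g = (\<lambda>w\<in>topspace Z'. map_sum (\<Psi> g) (\<Psi> g) w)" for g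
  have \<Psi>'_i: "\<Psi>' g (i v) = i (\<Psi> g v)" if "v \<in> topspace Z" for g v
    using that by (simp add: \<Psi>'_def top) (simp add: i_def)
  have \<Psi>'_j: "\<Psi>' g (j v) = j (\<Psi> g v)" if g: "g \<in> carrier G" and v: "v \<in> topspace Z" for g v
  proof (cases "v \<in> e ` topspace X")
    case True
    then obtain x where "x \<in> topspace X" "v = e x" by auto
    then show ?thesis
      using g by (simp add: j_e e_eq \<Psi>'_i \<phi>_eq \<phi>_in action_closed)
  next
    case False
    \<comment> \<open>The complement of the image of \<open>e\<close> is invariant, since
      \<open>inv g\<close> would carry \<open>v\<close> back into the image; so \<open>j\<close>
      stays in its \<open>Inr\<close> branch.\<close>
    have "\<Psi> g v \<notin> e ` topspace X"
    proof
      assume "\<Psi> g v \<in> e ` topspace X"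
      then obtain x where x: "x \<in> topspace X" "\<Psi> g v = e x" by auto
      then have "v = e (\<Phi> (inv g) x)"
        using hom_HomeoGroup_inv[OF hom g v] e_eq[of "inv g" x] g by simp
      then show False
        using False x g action_closed by auto
    qed
    then show ?thesis
      using False v by (simp add: \<Psi>'_def top) (simp add: j_def)
  qed
  have i_cont: "continuous_map Z Z' i" and j_cont: "continuous_map Z Z' j"
    by (simp_all add: Z'_def continuous_map_pushout_left continuous_map_pushout_right)
  have hom': "\<Psi>' \<in> hom G (HomeoGroup Z')"
  proof (rule hom_HomeoGroupI)
    show "\<Psi>' g \<in> extensional (topspace Z')" for g
      by (simp add: \<Psi>'_def)
    show "continuous_map Z' Z' (\<Psi>' g)" if g: "g \<in> carrier G" for g
    proof -
      note cont = hom_HomeoGroup_continuous[OF hom g]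
      have "continuous_map Z Z' (i \<circ> \<Psi> g)"
        using cont i_cont by (rule continuous_map_compose)
      then have i': "continuous_map Z Z' (\<Psi>' g \<circ> i)"
        by (rule continuous_map_eq) (simp add: \<Psi>'_i)
      have "continuous_map Z Z' (j \<circ> \<Psi> g)"
        using cont j_cont by (rule continuous_map_compose)
      then have "continuous_map Z Z' (\<Psi>' g \<circ> j)"
        by (rule continuous_map_eq) (simp add: g \<Psi>'_j)
      with i' show ?thesis
        unfolding Z'_def by (rule continuous_map_from_pushout)
    qed
    show "\<Psi>' \<one> w = w" if "w \<in> topspace Z'" for w
      using that by (auto simp: top \<Psi>'_i \<Psi>'_j hom_HomeoGroup_one[OF hom])
    show "\<Psi>' (g \<otimes> k) w = \<Psi>' g (\<Psi>' k w)"
      if "g \<in> carrier G" "k \<in> carrier G" "w \<in> topspace Z'" for g k w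
      using that
      by (auto simp: top \<Psi>'_i \<Psi>'_j hom_HomeoGroup_mult[OF hom] hom_HomeoGroup_closed[OF hom])
  qed
  have rep1: "representation Z' \<Psi>' (i \<circ> z)"
    by (rule representation_extend[OF rep i_cont i_inj hom']) (simp add: \<Psi>'_i)
  have rep2: "representation Z' \<Psi>' (j \<circ> z)"
    by (rule representation_extend[OF rep j_cont j_inj hom']) (simp add: \<Psi>'_j)
  \<comment> \<open>The first representation is the second after \<open>c\<close>. Undoing the
    second therefore leaves \<open>c\<close>, and surjectivity of \<open>c\<close> makes the images
    equal.\<close>
  have \<phi>12: "(i \<circ> z \<circ> joint_obs A h) x = (j \<circ> z \<circ> joint_obs A h) (c x)" if "x \<in> topspace X" for x
    using j_e[OF that] by (simp add: e_def \<phi>_def)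
  show thesis
  proof
    show "Hausdorff_space Z \<longrightarrow> Hausdorff_space Z'"
      unfolding Z'_def
      using Hausdorff_space_pushout[OF compact Hausdorff _ _ \<phi>_cont \<phi>_inj e_cont e_inj i_inj j_inj glue]
      by blast
    have "(i \<circ> z \<circ> joint_obs A h) ` topspace X = (\<lambda>x. (j \<circ> z \<circ> joint_obs A h) (c x)) ` topspace X"
      using \<phi>12 by (rule image_cong[OF refl])
    also have "\<dots> = (j \<circ> z \<circ> joint_obs A h) ` c ` topspace X"
      by (simp only: image_image)
    finally show "(i \<circ> z \<circ> joint_obs A h) ` topspace X = (j \<circ> z \<circ> joint_obs A h) ` topspace X"
      by (simp only: c_img)
    show "ambiguity X (i \<circ> z \<circ> joint_obs A h) (j \<circ> z \<circ> joint_obs A h) = c"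
    proof (rule extensionalityI[OF _ c_ext])
      fix x assume x: "x \<in> topspace X"
      show "ambiguity X (i \<circ> z \<circ> joint_obs A h) (j \<circ> z \<circ> joint_obs A h) x = c x"
        unfolding ambiguity_def restrict_apply'[OF x] \<phi>12[OF x]
        by (rule inv_into_f_f[OF representation_inj[OF rep2] c_in[OF x]])
    qed (simp add: ambiguity_def)
  qed (use rep1 rep2 in auto)
qed

end

theorem corollary3p8:
  fixes G :: "('g, 'm) monoid_scheme"
    and TG :: "'g topology"
    and X :: "'x topology"
    and \<Phi> :: "'g \<Rightarrow> 'x \<Rightarrow> 'x"
    and A :: "'a set"
    and Y :: "'a \<Rightarrow> 'y topology"
    and h :: "'a \<Rightarrow> 'x \<Rightarrow> 'y"
    and T :: "'g \<Rightarrow> 'a \<Rightarrow> 'y \<Rightarrow> 'y"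
    and Pol :: "'p set"
    and K :: "nat set"
    and P :: "'p \<Rightarrow> nat \<Rightarrow> 'x \<Rightarrow> (nat \<Rightarrow> 'a \<Rightarrow> 'y) measure"
    and x0 :: 'x
  assumes "finite A"
    and "\<And>g \<alpha>. g \<in> carrier G \<Longrightarrow> \<alpha> \<in> A \<Longrightarrow> T g \<alpha> \<in> topspace (Y \<alpha>) \<rightarrow> topspace (Y \<alpha>)"
    and "countable Pol"
    and "countable K"
    and "\<And>\<pi> k x. \<pi> \<in> Pol \<Longrightarrow> k \<in> K \<Longrightarrow> x \<in> topspace X \<Longrightarrow>
           P \<pi> k x \<in> space (prob_algebra (obs_seq_space Y A k))"
    and E1: "compact_space X" "connected_space X" "Hausdorff_space X"
            "topological_group G TG" "\<Phi> \<in> hom G (HomeoGroup X)"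
    and E2: "\<And>\<alpha>. \<alpha> \<in> A \<Longrightarrow> continuous_map X (Y \<alpha>) (h \<alpha>)"
            "\<And>x x'. x \<in> topspace X \<Longrightarrow> x' \<in> topspace X \<Longrightarrow> x \<noteq> x' \<Longrightarrow>
               \<exists>\<alpha>\<in>A. h \<alpha> x \<noteq> h \<alpha> x'"
    and E3: "\<And>\<alpha> g x. \<alpha> \<in> A \<Longrightarrow> g \<in> carrier G \<Longrightarrow> x \<in> topspace X \<Longrightarrow>
               h \<alpha> (\<Phi> g x) = T g \<alpha> (h \<alpha> x)"
    and E4: "\<And>x x'. x \<in> topspace X \<Longrightarrow> x' \<in> topspace X \<Longrightarrow> x \<noteq> x' \<Longrightarrow>
               \<exists>\<pi>\<in>Pol. \<exists>k\<in>K. P \<pi> k x \<noteq> P \<pi> k x'"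
    and simply_trans: "simply_transitive G X \<Phi>"
    and principal: "principal_homogeneous_space G TG X \<Phi>"
    and base: "x0 \<in> topspace X"
  shows
    "\<comment> \<open>the centraliser is \<open>G\<close> acting by right translations \<open>R a\<close>; the inverse is needed
        because \<open>R a \<circ> R b = R (b \<otimes> a)\<close>\<close>
     (\<lambda>a. right_translation G X \<Phi> x0 (inv\<^bsub>G\<^esub> a))
       \<in> iso G (centraliser (HomeoGroup X) (\<Phi> ` carrier G)) \<and>
     \<comment> \<open>every representation recovers \<open>X\<close> as a \<open>G\<close>-torsor\<close>
     (\<forall>(Z :: 'z topology) \<Psi> z \<phi>.
        latent_representation G X Y A h T Pol K P Z \<Psi> z \<and> \<phi> = z \<circ> joint_obs A h \<longrightarrow>
          inj_on \<phi> (topspace X) \<and>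
          (\<forall>g\<in>carrier G. \<forall>x\<in>topspace X. \<phi> (\<Phi> g x) = \<Psi> g (\<phi> x)) \<and>
          simply_transitive G (subtopology Z (\<phi> ` topspace X)) \<Psi> \<and>
          (Hausdorff_space Z \<longrightarrow>
             embedding_map X Z \<phi> \<and>
             principal_homogeneous_space G TG (subtopology Z (\<phi> ` topspace X))
               (\<lambda>g. restrict (\<Psi> g) (\<phi> ` topspace X)))) \<and>
     \<comment> \<open>no more: an ambiguity lies in the centraliser and is a unique right translation\<close>
     (\<forall>(Z :: 'z topology) \<Psi> z z' \<phi> \<phi>'.
        latent_representation G X Y A h T Pol K P Z \<Psi> z \<and> \<phi> = z \<circ> joint_obs A h \<and>
        latent_representation G X Y A h T Pol K P Z \<Psi> z' \<and> \<phi>' = z' \<circ> joint_obs A h \<and>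
        \<phi> ` topspace X \<subseteq> \<phi>' ` topspace X \<longrightarrow>
          ambiguity X \<phi> \<phi>' \<in> carrier (centraliser (HomeoGroup X) (\<Phi> ` carrier G)) \<and>
          (\<exists>!a. a \<in> carrier G \<and> ambiguity X \<phi> \<phi>' = right_translation G X \<Phi> x0 a)) \<and>
     \<comment> \<open>no less: as soon as \<open>X\<close> has a representation, every element of the centraliser is an
        ambiguity; \<open>Z\<close> has to be enlarged, since an equivariant encoder realising \<open>c\<close> on all of
        the observation space need not exist with values in the same \<open>Z\<close>\<close>
     (\<forall>(Z :: 'z topology) \<Psi> z. latent_representation G X Y A h T Pol K P Z \<Psi> z \<longrightarrow>
        (\<forall>c \<in> carrier (centraliser (HomeoGroup X) (\<Phi> ` carrier G)).
           \<exists>(Z' :: ('z + 'z) topology) \<Psi>' z\<^sub>1 z\<^sub>2 \<phi>\<^sub>1 \<phi>\<^sub>2.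
             (Hausdorff_space Z \<longrightarrow> Hausdorff_space Z') \<and>
             latent_representation G X Y A h T Pol K P Z' \<Psi>' z\<^sub>1 \<and> \<phi>\<^sub>1 = z\<^sub>1 \<circ> joint_obs A h \<and>
             latent_representation G X Y A h T Pol K P Z' \<Psi>' z\<^sub>2 \<and> \<phi>\<^sub>2 = z\<^sub>2 \<circ> joint_obs A h \<and>
             \<phi>\<^sub>1 ` topspace X = \<phi>\<^sub>2 ` topspace X \<and>
             ambiguity X \<phi>\<^sub>1 \<phi>\<^sub>2 = c))"
proof -
  interpret group G
    using E1(4) by (simp add: topological_group_def)
  interpret observed_torsor G TG X \<Phi> x0 A Y h T Pol K P
    by unfold_locales (use E1 E2(1) E3 E4 principal base in \<open>simp_all add: topological_group_def\<close>)
  show ?thesis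
  proof (intro conjI allI impI ballI; (elim conjE)?; (simp only:)?)
    show "(\<lambda>a. R (inv\<^bsub>G\<^esub> a)) \<in> iso G (centraliser (HomeoGroup X) (\<Phi> ` carrier G))"
      by (rule right_translation_iso)
  next
    fix Z :: "'z topology" and \<Psi> z
    assume rep: "representation Z \<Psi> z"
    show "inj_on (z \<circ> joint_obs A h) (topspace X)"
      using rep by (rule representation_inj)
    show "simply_transitive G (subtopology Z ((z \<circ> joint_obs A h) ` topspace X)) \<Psi>"
      using rep by (rule representation_simply_transitive)
    show "(z \<circ> joint_obs A h) (\<Phi> g x) = \<Psi> g ((z \<circ> joint_obs A h) x)"
      if "g \<in> carrier G" "x \<in> topspace X" for g x
      using rep that by (rule representation_equivariant)
    assume Z: "Hausdorff_space Z"
    show "embedding_map X Z (z \<circ> joint_obs A h)"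
      using rep Z by (rule representation_embedding)
    show "principal_homogeneous_space G TG (subtopology Z ((z \<circ> joint_obs A h) ` topspace X))
        (\<lambda>g. restrict (\<Psi> g) ((z \<circ> joint_obs A h) ` topspace X))"
      using rep Z by (rule representation_torsor)
  next
    fix Z :: "'z topology" and \<Psi> and z z' :: "('a \<Rightarrow> 'y) \<Rightarrow> 'z"
    let ?\<phi> = "z \<circ> joint_obs A h" and ?\<phi>' = "z' \<circ> joint_obs A h"
    assume "representation Z \<Psi> z" "representation Z \<Psi> z'"
      "?\<phi> ` topspace X \<subseteq> ?\<phi>' ` topspace X"
    then show unique: "\<exists>!a. a \<in> carrier G \<and> ambiguity X ?\<phi> ?\<phi>' = R a"
      by (rule ambiguity_equivariant)
    \<comment> \<open>That the ambiguity is a homeomorphism is inherited from right translations;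
      \<open>Z\<close> may fail to be Hausdorff, so continuity of the inverse of
      \<open>?\<phi>'\<close> is not at hand.\<close>
    then show "ambiguity X ?\<phi> ?\<phi>' \<in> carrier (centraliser (HomeoGroup X) (\<Phi> ` carrier G))"
      using right_translation_in_centraliser by (elim ex1E conjE) simp
  next
    fix Z :: "'z topology" and \<Psi> z c
    assume rep: "representation Z \<Psi> z" and c: "c \<in> carrier (centraliser (HomeoGroup X) (\<Phi> ` carrier G))"
    obtain Z' :: "('z + 'z) topology" and \<Psi>' z1 z2
      where *: "Hausdorff_space Z \<longrightarrow> Hausdorff_space Z'"
        "representation Z' \<Psi>' z1" "representation Z' \<Psi>' z2"
        "(z1 \<circ> joint_obs A h) ` topspace X = (z2 \<circ> joint_obs A h) ` topspace X"
        "ambiguity X (z1 \<circ> joint_obs A h) (z2 \<circ> joint_obs A h) = c"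
      using centraliser_realised[OF rep c] .
    show "\<exists>(Z' :: ('z + 'z) topology) \<Psi>' z1 z2 \<phi>1 \<phi>2.
        (Hausdorff_space Z \<longrightarrow> Hausdorff_space Z') \<and>
        representation Z' \<Psi>' z1 \<and> \<phi>1 = z1 \<circ> joint_obs A h \<and>
        representation Z' \<Psi>' z2 \<and> \<phi>2 = z2 \<circ> joint_obs A h \<and>
        \<phi>1 ` topspace X = \<phi>2 ` topspace X \<and> ambiguity X \<phi>1 \<phi>2 = c"
      by (rule exI[of _ Z'], rule exI[of _ \<Psi>'], rule exI[of _ z1], rule exI[of _ z2],
          rule exI[of _ "z1 \<circ> joint_obs A h"], rule exI[of _ "z2 \<circ> joint_obs A h"])
        (intro conjI refl *)
  qed
qed

end
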